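(* Let $n\ge 2$. Consider $RIC$ as a function of the $n(n-1)/2$ real variables $\varphi_{ij}\in[0,\pi/2]$, $1\le i<j\le n$, given by $$RIC=1-\frac{2\sum_{i=1}^{n-1}\sum_{j=i+1}^{n}\cos\varphi_{ij}}{n(n-1)}.$$ Then $RIC$ is a (strictly) increasing function of each argument $\varphi_{ij}$, the other arguments being fixed.
   Context: The row inconsistency index of a reciprocal positive $n\times n$ matrix is the displayed expression, where $\varphi_{ij}$ is the angle between the $i$-th and $j$-th rows; since the entries are positive these angles lie in $[0,\pi/2]$. Here the expression is viewed as a function of the angles as independent variables. *)

theory Defs
  imports "HOL-Analysis.Analysis"
begin

text \<open>The row inconsistency index as a function of the angles alone: the \<open>n(n-1)/2\<close> real variables
  are the values \<open>\<phi> (i, j)\<close> with \<open>(i, j) \<in> index_pairs n\<close>; other values of \<open>\<phi>\<close> do not matter.\<close>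

definition index_pairs :: "nat \<Rightarrow> (nat \<times> nat) set" where
  "index_pairs n = {(i, j). 1 \<le> i \<and> i < j \<and> j \<le> n}"

definition RIC :: "nat \<Rightarrow> (nat \<times> nat \<Rightarrow> real) \<Rightarrow> real" where
  "RIC n \<phi> =
     1 - 2 * (\<Sum>i = 1..n - 1. \<Sum>j = i + 1..n. cos (\<phi> (i, j))) / (real n * (real n - 1))"

end

theory Submission
  imports Defs
begin

text \<open>Exactly one summand of the double sum involves the angle being varied. Isolating it
  (\<open>RIC_fun_upd\<close>) shows the index to be a constant minus a positive multiple of that
  angle's cosine, and cosine strictly decreases on [0, \<pi>/2].\<close>

lemma index_pairs_eq_Sigma: "index_pairs n = (SIGMA i:{1..n - 1}. {i + 1..n})"
  by (auto simp: index_pairs_def)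

lemma finite_index_pairs [simp]: "finite (index_pairs n)"
  by (simp add: index_pairs_eq_Sigma)

text \<open>Flattening the nested sums lets a single pair be split off by
  \<open>sum.remove\<close>.\<close>

lemma RIC_eq_sum_index_pairs:
  "RIC n \<phi> = 1 - 2 * (\<Sum>x\<in>index_pairs n. cos (\<phi> x)) / (real n * (real n - 1))"
  by (simp add: RIC_def index_pairs_eq_Sigma sum.Sigma split_def)

lemma RIC_fun_upd:
  assumes "x \<in> index_pairs n"
  shows "RIC n (\<phi>(x := t)) =
    1 - 2 * (cos t + (\<Sum>y\<in>index_pairs n - {x}. cos (\<phi> y))) / (real n * (real n - 1))"
  using assms by (simp add: RIC_eq_sum_index_pairs sum.remove)

theorem proposition4:
  fixes n p q :: nat and \<phi> :: "nat \<times> nat \<Rightarrow> real"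
  assumes "n \<ge> 2"
    and "\<phi> \<in> index_pairs n \<rightarrow> {0..pi/2}"
    and "(p, q) \<in> index_pairs n"
  shows "strict_mono_on {0..pi/2} (\<lambda>t. RIC n (\<phi>((p, q) := t)))"
proof (rule strict_mono_onI)
  fix s t :: real
  assume "s \<in> {0..pi/2}" "t \<in> {0..pi/2}" "s < t"
  then have "cos t < cos s"
    by (intro cos_monotone_0_pi) auto
  \<comment> \<open>For \<open>n < 2\<close> this denominator would be 0, and division by zero would
    make the index constantly 1.\<close>
  moreover have "real n * (real n - 1) > 0"
    using assms(1) by simp
  ultimately show "RIC n (\<phi>((p, q) := s)) < RIC n (\<phi>((p, q) := t))"
    by (simp add: RIC_fun_upd[OF assms(3)] divide_strict_right_mono)
qed

end
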